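(* Let $A\in\mathbb{R}^{n\times n}$, $B\in\mathbb{R}^{n\times m}$, $C\in\mathbb{R}^{p\times n}$. Assume all eigenvalues of $A$ lie in the closed unit disc, $(A,B)$ is stabilizable and $(A,C)$ is detectable. Then the scalable delayed regulated state synchronization problem (defined in the context) is solvable. In particular, let $K\in\mathbb{R}^{m\times n}$ and $H\in\mathbb{R}^{n\times p}$ be such that $A-BK$ and $A-HC$ are Schur stable (these depend only on the agent model), and let each agent $i$ use the protocol $$\begin{aligned}\hat x_i(k+1)&=A\hat x_i(k)-BK\hat\zeta_i(k)+H\big(\bar\zeta_i(k)-C\hat x_i(k)\big),\\ \chi_i(k+1)&=A\chi_i(k)+Bu_i(k)+A\hat x_i(k)-A\hat\zeta_i(k),\\ u_i(k)&=-K\chi_i(k),\end{aligned}$$ with $\hat x_i(k),\chi_i(k)\in\mathbb{R}^n$ and with exchanged variable $\xi_i=\chi_i$, i.e. $\hat\zeta_i(k)=\chi_i(k)-\sum_{j=1}^N\bar d_{ij}\chi_j(k-\hat\kappa_{ij})$. Then for every $N$, every graph $\mathcal{G}\in\mathbb{G}^N$, all communication delays $\kappa_{ij}$, $\hat\kappa_{ij}$ and all initial conditions, delayed regulated state synchronization is achieved: $$\lim_{k\to\infty}\big[x_i(k)-x_r(k-\kappa_{ir})\big]=0\quad\text{for all } i\in\{1,\dots,N\}.$$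
   Context: Schur stable: all eigenvalues of the square matrix lie in the open unit disc. Agents: for $i=1,\dots,N$, $x_i(k+1)=Ax_i(k)+Bu_i(k)$, $y_i(k)=Cx_i(k)$, with $x_i\in\mathbb{R}^n$, $u_i\in\mathbb{R}^m$, $y_i\in\mathbb{R}^p$. Exosystem: $x_r(k+1)=Ax_r(k)$, $y_r(k)=Cx_r(k)$, $x_r(0)=x_{r0}$ arbitrary. Graphs: a weighted graph on nodes $\{1,\dots,N\}$ has weights $a_{ij}\ge 0$, $a_{ii}=0$, where $a_{ij}>0$ iff there is an edge from $j$ to $i$. Its Laplacian $L=[\ell_{ij}]$ has $\ell_{ii}=\sum_k a_{ik}$ and $\ell_{ij}=-a_{ij}$ for $i\ne j$. $\mathbb{G}^N$ is the set of weighted graphs on $N$ nodes that are themselves directed spanning trees (one root with no parent, every other node has exactly one parent, and the root has a directed path to every other node), with nodes numbered so that $L$ is lower triangular; thus node $1$ is the root, the first row of $L$ is zero, and $\ell_{ii}>0$ for $i\ge 2$. Expanded Laplacian: $\iota_1=1$, $\iota_i=0$ for $i\ge2$ (only the root agent receives exosystem information); $\bar L=[\bar\ell_{ij}]=L+\mathrm{diag}\{\iota_i\}$; $d_{in}(i)=\sum_j a_{ij}$, $D_{in}=\mathrm{diag}\{d_{in}(i)\}$; $\bar D=[\bar d_{ij}]=I-(2I+D_{in})^{-1}\bar L$. Delays: for $j\neq i$, $\kappa_{ij}\in\mathbb{N}^+$ and $\hat\kappa_{ij}\in\mathbb{N}^+$ are unknown constant communication delays from agent $j$ to agent $i$ (relevant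 only when $a_{ij}>0$), for the output exchange and for the protocol-variable exchange respectively; $\kappa_{ii}=\hat\kappa_{ii}=0$. $\kappa_{1r}$ is the unknown constant nonnegative integer delay from the exosystem to agent $1$. For $i\ge2$, $\kappa_{ir}$ is the sum of the delays ($\kappa_{1r}$ and the $\kappa$'s of the edges) along the unique path from the exosystem via agent 1 to agent $i$, so $\kappa_{ij}=\kappa_{ir}-\kappa_{jr}$ for each edge from $j$ to $i$. Information available to agent $i$: $$\bar\zeta_i(k)=\frac{1}{2+d_{in}(i)}\sum_{j=1}^N\bar\ell_{ij}\big(y_j(k-\kappa_{ij})-y_r(k-\kappa_{ir})\big)=y_i(k)-y_r(k-\kappa_{ir})-\sum_{j=1}^N\bar d_{ij}\big(y_j(k-\kappa_{ij})-y_r(k-\kappa_{ir})\big),$$ $$\hat\zeta_i(k)=\frac{1}{2+d_{in}(i)}\sum_{j=1}^N\bar\ell_{ij}\xi_j(k-\hat\kappa_{ij})=\xi_i(k)-\sum_{j=1}^N\bar d_{ij}\xi_j(k-\hat\kappa_{ij}),$$ where $\xi_j\in\mathbb{R}^n$ is a variable produced by the protocol of agent $j$. Initial conditions include arbitrary initial data at the finitely many negative times needed by the delays. Scalable delayed regulated state synchronization problem: find, using only knowledge of the agent model $(A,B,C)$ (in particular not of $N$, the graph, or the delays), matrices $A_c,B_{c1},B_{c2},F_c,H_c$ such that the protocol $$x_{c,i}(k+1)=A_cx_{c,i}(k)+B_{c1}\bar\zeta_i(k)+B_{c2}\hat\zeta_i(k),\quad u_i(k)=F_cx_{c,i}(k),\quad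 \xi_i(k)=H_cx_{c,i}(k),$$ $x_{c,i}\in\mathbb{R}^{n_c}$, achieves, for any $N$, any graph $\mathcal{G}\in\mathbb{G}^N$, any delays $\kappa_{ij},\hat\kappa_{ij}$ and any initial conditions, $\lim_{k\to\infty}[x_i(k)-x_r(k-\kappa_{ir})]=0$ for all $i\in\{1,\dots,N\}$. *)

theory Defs
  imports Complex_Main "Jordan_Normal_Form.Char_Poly"
begin

(* All dimensions are natural numbers (matrices and vectors of Jordan_Normal_Form with carrier
   constraints), because the number of agents and the order of the protocol are quantified
   inside the notion of solvability. *)

section \<open>Stability notions for real matrices\<close>

definition schur_stable :: "real mat \<Rightarrow> bool" where
  "schur_stable M \<longleftrightarrow> (\<forall>l. eigenvalue (map_mat complex_of_real M) l \<longrightarrow> cmod l < 1)"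

definition spectrum_in_closed_disc :: "real mat \<Rightarrow> bool" where
  "spectrum_in_closed_disc M \<longleftrightarrow>
     (\<forall>l. eigenvalue (map_mat complex_of_real M) l \<longrightarrow> cmod l \<le> 1)"

definition stabilizable :: "nat \<Rightarrow> nat \<Rightarrow> real mat \<Rightarrow> real mat \<Rightarrow> bool" where
  "stabilizable n m A B \<longleftrightarrow> (\<exists>K \<in> carrier_mat m n. schur_stable (A - B * K))"

definition detectable :: "nat \<Rightarrow> nat \<Rightarrow> real mat \<Rightarrow> real mat \<Rightarrow> bool" where
  "detectable n p A C \<longleftrightarrow> (\<exists>H \<in> carrier_mat n p. schur_stable (A - H * C))"

section \<open>Weighted graphs on the nodes 1, ..., N\<close>

definition weighted_graph :: "nat \<Rightarrow> (nat \<Rightarrow> nat \<Rightarrow> real) \<Rightarrow> bool" where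
  "weighted_graph N a \<longleftrightarrow> (\<forall>i\<in>{1..N}. a i i = 0 \<and> (\<forall>j\<in>{1..N}. 0 \<le> a i j))"

(* parent N a j i: there is an edge from j to i. The weight a i j belongs to the edge j -> i. *)
definition parent :: "nat \<Rightarrow> (nat \<Rightarrow> nat \<Rightarrow> real) \<Rightarrow> nat \<Rightarrow> nat \<Rightarrow> bool" where
  "parent N a j i \<longleftrightarrow> j \<in> {1..N} \<and> i \<in> {1..N} \<and> 0 < a i j"

definition directed_path :: "nat \<Rightarrow> (nat \<Rightarrow> nat \<Rightarrow> real) \<Rightarrow> nat \<Rightarrow> nat list \<Rightarrow> nat \<Rightarrow> bool" where
  "directed_path N a j vs i \<longleftrightarrow> vs \<noteq> [] \<and> hd vs = j \<and> last vs = i \<and> distinct vs \<and>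
     set vs \<subseteq> {1..N} \<and> successively (parent N a) vs"

definition directed_spanning_tree :: "nat \<Rightarrow> (nat \<Rightarrow> nat \<Rightarrow> real) \<Rightarrow> bool" where
  "directed_spanning_tree N a \<longleftrightarrow>
     (\<exists>r\<in>{1..N}. (\<forall>j. \<not> parent N a j r) \<and>
        (\<forall>i\<in>{1..N}. i \<noteq> r \<longrightarrow> (\<exists>!j. parent N a j i) \<and> (\<exists>vs. directed_path N a r vs i)))"

definition d_in :: "nat \<Rightarrow> (nat \<Rightarrow> nat \<Rightarrow> real) \<Rightarrow> nat \<Rightarrow> real" where
  "d_in N a i = (\<Sum>j=1..N. a i j)"

definition laplacian :: "nat \<Rightarrow> (nat \<Rightarrow> nat \<Rightarrow> real) \<Rightarrow> nat \<Rightarrow> nat \<Rightarrow> real" where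
  "laplacian N a i j = (if i = j then (\<Sum>k=1..N. a i k) else - a i j)"

definition graph_class :: "nat \<Rightarrow> (nat \<Rightarrow> nat \<Rightarrow> real) \<Rightarrow> bool" where
  "graph_class N a \<longleftrightarrow> weighted_graph N a \<and> directed_spanning_tree N a \<and>
     (\<forall>i\<in>{1..N}. \<forall>j\<in>{1..N}. i < j \<longrightarrow> laplacian N a i j = 0)"

definition iota :: "nat \<Rightarrow> real" where
  "iota i = (if i = 1 then 1 else 0)"

definition l_bar :: "nat \<Rightarrow> (nat \<Rightarrow> nat \<Rightarrow> real) \<Rightarrow> nat \<Rightarrow> nat \<Rightarrow> real" where
  "l_bar N a i j = laplacian N a i j + (if i = j then iota i else 0)"

(* entries of I - (2 I + D_in)^(-1) * L_bar; the inverted matrix is diagonal *)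
definition d_bar :: "nat \<Rightarrow> (nat \<Rightarrow> nat \<Rightarrow> real) \<Rightarrow> nat \<Rightarrow> nat \<Rightarrow> real" where
  "d_bar N a i j = (if i = j then 1 else 0) - l_bar N a i j / (2 + d_in N a i)"

section \<open>Delays\<close>

definition comm_delays :: "nat \<Rightarrow> (nat \<Rightarrow> nat \<Rightarrow> nat) \<Rightarrow> bool" where
  "comm_delays N \<kappa> \<longleftrightarrow>
     (\<forall>i\<in>{1..N}. \<kappa> i i = 0 \<and> (\<forall>j\<in>{1..N}. j \<noteq> i \<longrightarrow> 0 < \<kappa> i j))"

fun path_delay :: "(nat \<Rightarrow> nat \<Rightarrow> nat) \<Rightarrow> nat list \<Rightarrow> nat" where
  "path_delay \<kappa> (j # i # vs) = \<kappa> i j + path_delay \<kappa> (i # vs)"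
| "path_delay \<kappa> vs = 0"

(* The delay from the exosystem to agent i; \<kappa>1r is the delay from the exosystem to agent 1. *)
definition exo_delay ::
  "nat \<Rightarrow> (nat \<Rightarrow> nat \<Rightarrow> real) \<Rightarrow> (nat \<Rightarrow> nat \<Rightarrow> nat) \<Rightarrow> nat \<Rightarrow> nat \<Rightarrow> nat" where
  "exo_delay N a \<kappa> \<kappa>1r i = \<kappa>1r + path_delay \<kappa> (THE vs. directed_path N a 1 vs i)"

section \<open>Agents, exosystem and exchanged information\<close>

(* Signals are defined at all integer times. Dynamics are only imposed at times k >= 0, so the
   values at negative times are arbitrary initial data. *)
type_synonym signal = "int \<Rightarrow> real vec"

definition is_signal :: "nat \<Rightarrow> signal \<Rightarrow> bool" where
  "is_signal d s \<longleftrightarrow> (\<forall>k. s k \<in> carrier_vec d)"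

definition exosystem :: "nat \<Rightarrow> nat \<Rightarrow> real mat \<Rightarrow> real mat \<Rightarrow> signal \<Rightarrow> signal \<Rightarrow> bool" where
  "exosystem n p A C xr yr \<longleftrightarrow> is_signal n xr \<and> is_signal p yr \<and>
     (\<forall>k\<ge>0. xr (k + 1) = A *\<^sub>v xr k \<and> yr k = C *\<^sub>v xr k)"

definition agents :: "nat \<Rightarrow> nat \<Rightarrow> nat \<Rightarrow> real mat \<Rightarrow> real mat \<Rightarrow> real mat \<Rightarrow> nat \<Rightarrow>
    (nat \<Rightarrow> signal) \<Rightarrow> (nat \<Rightarrow> signal) \<Rightarrow> (nat \<Rightarrow> signal) \<Rightarrow> bool" where
  "agents n m p A B C N x u y \<longleftrightarrow>
     (\<forall>i\<in>{1..N}. is_signal n (x i) \<and> is_signal m (u i) \<and> is_signal p (y i) \<and>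
        (\<forall>k\<ge>0. x i (k + 1) = A *\<^sub>v x i k + B *\<^sub>v u i k \<and> y i k = C *\<^sub>v x i k))"

(* The vector sum over j = 1, ..., N of c j * v j in dimension d *)
definition lin_comb :: "nat \<Rightarrow> nat \<Rightarrow> (nat \<Rightarrow> real) \<Rightarrow> (nat \<Rightarrow> real vec) \<Rightarrow> real vec" where
  "lin_comb d N c v = vec d (\<lambda>q. \<Sum>j=1..N. c j * v j $ q)"

definition zeta_bar :: "nat \<Rightarrow> nat \<Rightarrow> (nat \<Rightarrow> nat \<Rightarrow> real) \<Rightarrow> (nat \<Rightarrow> nat \<Rightarrow> nat) \<Rightarrow> nat \<Rightarrow>
    (nat \<Rightarrow> signal) \<Rightarrow> signal \<Rightarrow> nat \<Rightarrow> signal" where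
  "zeta_bar p N a \<kappa> \<kappa>1r y yr i k =
     (1 / (2 + d_in N a i)) \<cdot>\<^sub>v
       lin_comb p N (l_bar N a i)
         (\<lambda>j. y j (k - int (\<kappa> i j)) - yr (k - int (exo_delay N a \<kappa> \<kappa>1r i)))"

definition zeta_hat :: "nat \<Rightarrow> nat \<Rightarrow> (nat \<Rightarrow> nat \<Rightarrow> real) \<Rightarrow> (nat \<Rightarrow> nat \<Rightarrow> nat) \<Rightarrow>
    (nat \<Rightarrow> signal) \<Rightarrow> nat \<Rightarrow> signal" where
  "zeta_hat n N a \<kappa>h \<xi> i k =
     \<xi> i k - lin_comb n N (d_bar N a i) (\<lambda>j. \<xi> j (k - int (\<kappa>h i j)))"

section \<open>Scalable delayed regulated state synchronization\<close>

(* Vectors of type vec carry no topology; the limit is taken entrywise. *)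
definition synchronized :: "nat \<Rightarrow> nat \<Rightarrow> (nat \<Rightarrow> nat \<Rightarrow> real) \<Rightarrow> (nat \<Rightarrow> nat \<Rightarrow> nat) \<Rightarrow> nat \<Rightarrow>
    (nat \<Rightarrow> signal) \<Rightarrow> signal \<Rightarrow> bool" where
  "synchronized n N a \<kappa> \<kappa>1r x xr \<longleftrightarrow>
     (\<forall>i\<in>{1..N}. \<forall>q<n.
        ((\<lambda>k. (x i k - xr (k - int (exo_delay N a \<kappa> \<kappa>1r i))) $ q) \<longlongrightarrow> 0) at_top)"

definition protocol_synchronizes :: "nat \<Rightarrow> nat \<Rightarrow> nat \<Rightarrow> real mat \<Rightarrow> real mat \<Rightarrow> real mat \<Rightarrow> nat \<Rightarrow>
    real mat \<Rightarrow> real mat \<Rightarrow> real mat \<Rightarrow> real mat \<Rightarrow> real mat \<Rightarrow> bool" where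
  "protocol_synchronizes n m p A B C nc Ac Bc1 Bc2 Fc Hc \<longleftrightarrow>
     (\<forall>N a \<kappa> \<kappa>h \<kappa>1r xr yr x u y xc \<xi>.
        graph_class N a \<longrightarrow> comm_delays N \<kappa> \<longrightarrow> comm_delays N \<kappa>h \<longrightarrow>
        exosystem n p A C xr yr \<longrightarrow> agents n m p A B C N x u y \<longrightarrow>
        (\<forall>i\<in>{1..N}. is_signal nc (xc i) \<and> is_signal n (\<xi> i) \<and>
           (\<forall>k\<ge>0. xc i (k + 1) = Ac *\<^sub>v xc i k + Bc1 *\<^sub>v zeta_bar p N a \<kappa> \<kappa>1r y yr i k
                      + Bc2 *\<^sub>v zeta_hat n N a \<kappa>h \<xi> i k \<and>
                  u i k = Fc *\<^sub>v xc i k \<and>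
                  \<xi> i k = Hc *\<^sub>v xc i k)) \<longrightarrow>
        synchronized n N a \<kappa> \<kappa>1r x xr)"

definition scalable_sync_solvable ::
  "nat \<Rightarrow> nat \<Rightarrow> nat \<Rightarrow> real mat \<Rightarrow> real mat \<Rightarrow> real mat \<Rightarrow> bool" where
  "scalable_sync_solvable n m p A B C \<longleftrightarrow>
     (\<exists>nc. \<exists>Ac \<in> carrier_mat nc nc. \<exists>Bc1 \<in> carrier_mat nc p. \<exists>Bc2 \<in> carrier_mat nc n.
        \<exists>Fc \<in> carrier_mat m nc. \<exists>Hc \<in> carrier_mat n nc.
          protocol_synchronizes n m p A B C nc Ac Bc1 Bc2 Fc Hc)"

section \<open>Consistency of the definitions\<close>

lemma d_in_nonneg:
  assumes "weighted_graph N a" "i \<in> {1..N}"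
  shows "0 \<le> d_in N a i"
  using assms unfolding weighted_graph_def d_in_def by (auto intro!: sum_nonneg)

lemma sum_d_bar:
  fixes f :: "nat \<Rightarrow> real"
  assumes "i \<in> {1..N}"
  shows "(\<Sum>j=1..N. d_bar N a i j * f j) =
    f i - (1 / (2 + d_in N a i)) * (\<Sum>j=1..N. l_bar N a i j * f j)"
proof -
  have "(\<Sum>j=1..N. d_bar N a i j * f j) =
     (\<Sum>j=1..N. (if i = j then f j else 0) - (1 / (2 + d_in N a i)) * (l_bar N a i j * f j))"
    by (rule sum.cong) (auto simp: d_bar_def algebra_simps)
  also have "\<dots> = f i - (1 / (2 + d_in N a i)) * (\<Sum>j=1..N. l_bar N a i j * f j)"
    using assms by (simp add: sum_subtractf sum.delta sum_distrib_left)
  finally show ?thesis .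
qed

lemma zeta_bar_alt:
  assumes i: "i \<in> {1..N}" and \<kappa>: "comm_delays N \<kappa>"
    and y: "\<forall>j\<in>{1..N}. is_signal p (y j)" and yr: "is_signal p yr"
  shows "zeta_bar p N a \<kappa> \<kappa>1r y yr i k =
    (y i k - yr (k - int (exo_delay N a \<kappa> \<kappa>1r i))) -
    lin_comb p N (d_bar N a i)
      (\<lambda>j. y j (k - int (\<kappa> i j)) - yr (k - int (exo_delay N a \<kappa> \<kappa>1r i)))"
  (is "?l = ?r")
proof (rule eq_vecI)
  have c: "y i k' \<in> carrier_vec p" "yr k' \<in> carrier_vec p" for k'
    using i y yr by (auto simp: is_signal_def)
  have k0: "\<kappa> i i = 0" using i \<kappa> by (auto simp: comm_delays_def)
  show "dim_vec ?l = dim_vec ?r" by (simp add: zeta_bar_def lin_comb_def)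
  fix q assume "q < dim_vec ?r"
  then have q: "q < p" by (simp add: lin_comb_def)
  show "?l $ q = ?r $ q"
    using q k0 c
      sum_d_bar[OF i, of a "\<lambda>j. (y j (k - int (\<kappa> i j)) - yr (k - int (exo_delay N a \<kappa> \<kappa>1r i))) $ q"]
    by (simp add: zeta_bar_def lin_comb_def)
qed

lemma zeta_hat_alt:
  assumes i: "i \<in> {1..N}" and \<kappa>: "comm_delays N \<kappa>h"
    and \<xi>: "\<forall>j\<in>{1..N}. is_signal n (\<xi> j)"
  shows "zeta_hat n N a \<kappa>h \<xi> i k =
    (1 / (2 + d_in N a i)) \<cdot>\<^sub>v lin_comb n N (l_bar N a i) (\<lambda>j. \<xi> j (k - int (\<kappa>h i j)))"
  (is "?l = ?r")
proof (rule eq_vecI)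
  have c: "\<xi> i k' \<in> carrier_vec n" for k'
    using i \<xi> by (auto simp: is_signal_def)
  have k0: "\<kappa>h i i = 0" using i \<kappa> by (auto simp: comm_delays_def)
  show "dim_vec ?l = dim_vec ?r" by (simp add: zeta_hat_def lin_comb_def)
  fix q assume "q < dim_vec ?r"
  then have q: "q < n" by (simp add: lin_comb_def)
  show "?l $ q = ?r $ q"
    using q k0 c sum_d_bar[OF i, of a "\<lambda>j. \<xi> j (k - int (\<kappa>h i j)) $ q"]
    by (simp add: zeta_hat_def lin_comb_def)
qed

lemma parent_less:
  assumes "graph_class N a" "parent N a j i"
  shows "j < i"
proof (rule ccontr)
  assume "\<not> j < i"
  then consider "i = j" | "i < j" by linarith
  then show False
    using assms by cases (auto simp: graph_class_def weighted_graph_def laplacian_def parent_def)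
qed

lemma graph_class_root:
  assumes g: "graph_class N a"
  shows "1 \<in> {1..N}" "\<not> parent N a j 1"
    and "i \<in> {1..N} \<Longrightarrow> i \<noteq> 1 \<Longrightarrow> \<exists>!j. parent N a j i"
    and "i \<in> {1..N} \<Longrightarrow> \<exists>vs. directed_path N a 1 vs i"
proof -
  obtain r where r: "r \<in> {1..N}"
    "\<forall>i\<in>{1..N}. i \<noteq> r \<longrightarrow> (\<exists>!j. parent N a j i) \<and> (\<exists>vs. directed_path N a r vs i)"
    using g unfolding graph_class_def directed_spanning_tree_def by blast
  show n1: "\<not> parent N a j 1" for j
    using parent_less[OF g, of j 1] by (auto simp: parent_def)
  show 1: "1 \<in> {1..N}" using r(1) by auto
  have "r = 1" using r(2) 1 n1 by metis
  then show "i \<in> {1..N} \<Longrightarrow> i \<noteq> 1 \<Longrightarrow> \<exists>!j. parent N a j i" using r(2) by blast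
  have "directed_path N a 1 [1] 1" using 1 by (simp add: directed_path_def)
  then show "i \<in> {1..N} \<Longrightarrow> \<exists>vs. directed_path N a 1 vs i"
    using r(2) \<open>r = 1\<close> by (cases "i = 1") blast+
qed

lemma directed_path_to_1:
  assumes "directed_path N a 1 vs 1"
  shows "vs = [1]"
  using assms last_in_set by (cases vs) (fastforce simp: directed_path_def split: if_splits)+

lemma directed_path_split:
  assumes "directed_path N a 1 vs i" "i \<noteq> 1"
  obtains ws j where "vs = ws @ [i]" "directed_path N a 1 ws j" "parent N a j i"
proof -
  have "vs \<noteq> []" "last vs = i" using assms by (auto simp: directed_path_def)
  then have vs: "vs = butlast vs @ [i]" using append_butlast_last_id by metis
  moreover from this have ne: "butlast vs \<noteq> []"
    using assms by (metis append_Nil directed_path_def list.sel(1))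
  have p: "directed_path N a 1 (butlast vs @ [i]) i" using assms(1) vs by simp
  have "directed_path N a 1 (butlast vs) (last (butlast vs))"
    "parent N a (last (butlast vs)) i"
    using p ne by (auto simp: directed_path_def successively_append_iff)
  with vs that show ?thesis by blast
qed

lemma directed_path_unique:
  assumes g: "graph_class N a"
  shows "directed_path N a 1 vs i \<Longrightarrow> directed_path N a 1 ws i \<Longrightarrow> vs = ws"
proof (induction i arbitrary: vs ws rule: less_induct)
  case (less i)
  show ?case
  proof (cases "i = 1")
    case True
    then show ?thesis using less.prems directed_path_to_1 by blast
  next
    case False
    obtain vs' j where v: "vs = vs' @ [i]" "directed_path N a 1 vs' j" "parent N a j i"
      using directed_path_split[OF less.prems(1) False] .
    obtain ws' j' where w: "ws = ws' @ [i]" "directed_path N a 1 ws' j'" "parent N a j' i"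
      using directed_path_split[OF less.prems(2) False] .
    have "j = j'"
      using graph_class_root(3)[OF g _ False] v(3) w(3) unfolding parent_def by blast
    then show ?thesis using less.IH[OF parent_less[OF g v(3)]] v w by blast
  qed
qed

lemma path_delay_snoc:
  "vs \<noteq> [] \<Longrightarrow> path_delay \<kappa> (vs @ [i]) = path_delay \<kappa> vs + \<kappa> i (last vs)"
  by (induction \<kappa> vs rule: path_delay.induct) auto

lemma exo_delay_path:
  assumes "graph_class N a" "directed_path N a 1 vs i"
  shows "exo_delay N a \<kappa> \<kappa>1r i = \<kappa>1r + path_delay \<kappa> vs"
proof -
  have "(THE ws. directed_path N a 1 ws i) = vs"
    using assms directed_path_unique by (intro the_equality) auto
  then show ?thesis by (simp add: exo_delay_def)
qed

lemma exo_delay_root: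
  assumes g: "graph_class N a"
  shows "exo_delay N a \<kappa> \<kappa>1r 1 = \<kappa>1r"
proof -
  have "directed_path N a 1 [1] 1"
    using graph_class_root(1)[OF g] by (simp add: directed_path_def)
  then show ?thesis using exo_delay_path[OF g] by fastforce
qed

lemma exo_delay_parent:
  assumes g: "graph_class N a" and e: "parent N a j i"
  shows "exo_delay N a \<kappa> \<kappa>1r i = \<kappa> i j + exo_delay N a \<kappa> \<kappa>1r j"
proof -
  have i: "i \<in> {1..N}" "i \<noteq> 1" using e graph_class_root(2)[OF g] by (auto simp: parent_def)
  obtain vs where vs: "directed_path N a 1 vs i" using graph_class_root(4)[OF g i(1)] by blast
  obtain ws j' where w: "vs = ws @ [i]" "directed_path N a 1 ws j'" "parent N a j' i"
    using directed_path_split[OF vs i(2)] .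
  have "j' = j" using graph_class_root(3)[OF g i] w(3) e by blast
  moreover have "ws \<noteq> []" "last ws = j'" using w(2) by (auto simp: directed_path_def)
  ultimately show ?thesis
    using exo_delay_path[OF g vs] exo_delay_path[OF g w(2)] w(1)
    by (simp add: path_delay_snoc)
qed

end

theory Submission
  imports Defs "Jordan_Normal_Form.Spectral_Radius"
begin

text \<open>Since every agent has a single parent, with \<open>\<kappa>\<^sub>i\<^sub>r = \<kappa>\<^sub>i\<^sub>j + \<kappa>\<^sub>j\<^sub>r\<close>, the closed loop is a cascade along the
  tree: delayed copies of the parent's signals enter agent \<open>i\<close> only as inputs. Write
  \<open>e(k) = x\<^sub>i(k) - x\<^sub>r(k - \<kappa>\<^sub>i\<^sub>r)\<close> and let \<open>\<alpha> \<in> (0, 1)\<close> be the diagonal entry of \<open>(2 I + D\<^sub>i\<^sub>n)\<^sup>-\<^sup>1 L\<close>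
  (with the expanded Laplacian) at \<open>i\<close>. Up to inputs from the parent, which vanish by induction,
  the observer error of \<open>\<alpha> e\<close> is governed by \<open>A - H C\<close>, the difference \<open>e - \<chi>\<close> by \<open>(1 - \<alpha>) A\<close> and
  \<open>e\<close> itself by \<open>A - B K\<close>; each of these is Schur stable and is driven only by the preceding ones,
  and a Schur stable system with vanishing input has vanishing state.\<close>

section \<open>Geometric decay of the powers of a Schur stable matrix\<close>

lemma eigenvalue_smult_matD:
  fixes A :: "'a :: field mat"
  assumes A: "A \<in> carrier_mat n n" and c: "c \<noteq> 0" and ev: "eigenvalue (c \<cdot>\<^sub>m A) l"
  shows "eigenvalue A (l / c)"
proof -
  obtain v where v: "v \<in> carrier_vec n" "v \<noteq> 0\<^sub>v n" "(c \<cdot>\<^sub>m A) *\<^sub>v v = l \<cdot>\<^sub>v v"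
    using ev A unfolding eigenvalue_def eigenvector_def by auto
  have "A *\<^sub>v v = (l / c) \<cdot>\<^sub>v v"
  proof (rule eq_vecI)
    fix i assume "i < dim_vec ((l / c) \<cdot>\<^sub>v v)"
    then have i: "i < n" using v(1) by simp
    have "((c \<cdot>\<^sub>m A) *\<^sub>v v) $ i = (l \<cdot>\<^sub>v v) $ i" using v(3) by simp
    then show "(A *\<^sub>v v) $ i = ((l / c) \<cdot>\<^sub>v v) $ i"
      using A v(1) i c by (simp add: field_simps)
  qed (use A v in auto)
  then show ?thesis using A v unfolding eigenvalue_def eigenvector_def by auto
qed

lemma pow_smult_mat:
  fixes A :: "'a :: comm_ring_1 mat"
  assumes A: "A \<in> carrier_mat n n"
  shows "(c \<cdot>\<^sub>m A) ^\<^sub>m k = c ^ k \<cdot>\<^sub>m A ^\<^sub>m k"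
proof (induction k)
  case (Suc k)
  have P: "A ^\<^sub>m k \<in> carrier_mat n n" using A by simp
  have "(c \<cdot>\<^sub>m A) ^\<^sub>m Suc k = (c ^ k \<cdot>\<^sub>m A ^\<^sub>m k) * (c \<cdot>\<^sub>m A)" using Suc by simp
  also have "\<dots> = c ^ k \<cdot>\<^sub>m (c \<cdot>\<^sub>m (A ^\<^sub>m k * A))"
    using mult_smult_assoc_mat[OF P, of "c \<cdot>\<^sub>m A" n "c ^ k"] mult_smult_distrib[OF P A, of c] A
    by simp
  also have "\<dots> = c ^ Suc k \<cdot>\<^sub>m A ^\<^sub>m Suc k"
    by (rule eq_matI) (use A in \<open>auto simp: mult.assoc mult.left_commute\<close>)
  finally show ?case .
qed (use A in \<open>auto intro: eq_matI\<close>)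

text \<open>Scaling by a number between the spectral radius and 1 turns the boundedness of powers into
  geometric decay.\<close>
lemma schur_stable_pow_bound:
  assumes M: "M \<in> carrier_mat n n" and st: "schur_stable M"
  obtains c r where "0 \<le> c" "0 \<le> r" "r < 1"
    "\<And>k i j. i < n \<Longrightarrow> j < n \<Longrightarrow> \<bar>(M ^\<^sub>m k) $$ (i, j)\<bar> \<le> c * r ^ k"
proof (cases "n = 0")
  \<comment> \<open>The spectral radius is a maximum over the spectrum, which is empty in dimension
    0.\<close>
  case True
  then show ?thesis using that[of 0 0] by simp
next
  case False
  then have n: "n > 0" by simp
  define Mc where "Mc = map_mat complex_of_real M"
  have Mc: "Mc \<in> carrier_mat n n" using M by (simp add: Mc_def)
  define s where "s = spectral_radius Mc"
  have s: "0 \<le> s" "s < 1"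
    using spectral_radius_mem_max(1)[OF Mc n] st
    by (auto simp: s_def spectrum_def schur_stable_def Mc_def)
  \<comment> \<open>The midpoint lies strictly above \<open>s\<close>, so that \<open>D\<close> gets
    spectral radius below 1, and it is positive even for \<open>s = 0\<close>, so that division by
    \<open>r\<close> is legitimate.\<close>
  define r where "r = (s + 1) / 2"
  have r: "0 < r" "r < 1" "s < r" using s by (auto simp: r_def)
  define D where "D = complex_of_real (1 / r) \<cdot>\<^sub>m Mc"
  have D: "D \<in> carrier_mat n n" using Mc by (simp add: D_def)
  obtain l where l: "eigenvalue D l" "spectral_radius D = cmod l"
    using spectral_radius_mem_max(1)[OF D n] by (auto simp: spectrum_def)
  have "eigenvalue Mc (l / complex_of_real (1 / r))"
    using l(1) r unfolding D_def by (intro eigenvalue_smult_matD[OF Mc]) auto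
  then have "cmod (l / complex_of_real (1 / r)) \<le> s"
    using spectral_radius_mem_max(2)[OF Mc n] by (auto simp: s_def spectrum_def)
  then have "cmod l * r \<le> s" using r by (simp add: norm_mult norm_divide)
  then have "cmod l * r < 1 * r" using r by linarith
  then have "cmod l < 1" by (rule mult_right_less_imp_less) (use r in simp)
  then have "spectral_radius D < 1" using l(2) by simp
  from spectral_radius_jnf_norm_bound_less_1_upper_triangular[OF D this]
  obtain c where c: "norm_bound (D ^\<^sub>m k) c" for k by blast
  have bd: "\<bar>(M ^\<^sub>m k) $$ (i, j)\<bar> \<le> c * r ^ k" if ij: "i < n" "j < n" for k i j
  proof -
    have "cmod ((D ^\<^sub>m k) $$ (i, j)) \<le> c"
      using c[of k] D ij unfolding norm_bound_def by auto
    moreover have "(D ^\<^sub>m k) $$ (i, j) = complex_of_real (1 / r) ^ k * complex_of_real ((M ^\<^sub>m k) $$ (i, j))"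
      using ij M Mc unfolding D_def pow_smult_mat[OF Mc]
      by (simp add: Mc_def of_real_hom.mat_hom_pow[OF M, symmetric])
    ultimately have "\<bar>(M ^\<^sub>m k) $$ (i, j)\<bar> / r ^ k \<le> c"
      using r by (simp add: norm_mult norm_divide norm_power power_divide)
    then show ?thesis using r by (simp add: field_simps)
  qed
  have "0 \<le> c" using bd[of 0 0 0] n M by simp
  then show ?thesis using that[of c r] r bd by auto
qed

text \<open>Once \<open>b k\<close> is below \<open>(1 - r) * (e / 2)\<close>, the sequence is
  majorized by the recurrence with fixed point \<open>e / 2\<close>, and its excess over
  \<open>e / 2\<close> shrinks at least by the factor \<open>r\<close> per step.\<close>

lemma contraction_recurrence_tendsto_0:
  fixes s b :: "nat \<Rightarrow> real"
  assumes r: "0 \<le> r" "r < 1" and s0: "\<And>k. 0 \<le> s k"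
    and rec: "\<And>k. s (Suc k) \<le> r * s k + b k" and b: "b \<longlonglongrightarrow> 0"
  shows "s \<longlonglongrightarrow> 0"
proof (rule tendstoI)
  fix e :: real assume e: "e > 0"
  have "eventually (\<lambda>k. b k < (1 - r) * (e / 2)) sequentially"
    using b e r by (intro order_tendstoD) auto
  then obtain K where K: "\<And>k. k \<ge> K \<Longrightarrow> b k < (1 - r) * (e / 2)"
    by (auto simp: eventually_sequentially)
  have bd: "s (K + k) \<le> r ^ k * s K + e / 2" for k
  proof (induction k)
    case (Suc k)
    have "s (K + Suc k) \<le> r * s (K + k) + (1 - r) * (e / 2)"
      using rec[of "K + k"] K[of "K + k"] by simp
    also have "\<dots> \<le> r * (r ^ k * s K + e / 2) + (1 - r) * (e / 2)"
      using Suc r by (intro add_right_mono mult_left_mono) auto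
    also have "\<dots> = r ^ Suc k * s K + e / 2" by (simp add: field_simps)
    finally show ?case .
  qed (use e in simp)
  have "(\<lambda>k. r ^ k * s K) \<longlonglongrightarrow> 0"
    using LIMSEQ_power_zero[of r] r by (intro tendsto_mult_left_zero) auto
  then have "eventually (\<lambda>k. r ^ k * s K < e / 2) sequentially"
    using e by (intro order_tendstoD) auto
  then obtain L where L: "\<And>k. k \<ge> L \<Longrightarrow> r ^ k * s K < e / 2"
    by (auto simp: eventually_sequentially)
  have "dist (s k) 0 < e" if "k \<ge> K + L" for k
  proof -
    have "L \<le> k - K" using that by simp
    from L[OF this] bd[of "k - K"] that s0[of k] show ?thesis by simp
  qed
  then show "eventually (\<lambda>k. dist (s k) 0 < e) sequentially"
    by (auto simp: eventually_sequentially)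
qed

section \<open>Signals that vanish as time tends to infinity\<close>

lemma is_signal_dim: "is_signal d s \<Longrightarrow> dim_vec (s k) = d"
  by (auto simp: is_signal_def)

lemma is_signal_mult_mat: "M \<in> carrier_mat d d' \<Longrightarrow> is_signal d (\<lambda>k. M *\<^sub>v s k)"
  unfolding is_signal_def by (intro allI carrier_vecI) simp

text \<open>The limit is entrywise, as in \<open>synchronized\<close>. The filter
  \<open>at_top\<close> on integer times makes finite delays and initial segments invisible.\<close>

definition null_signal :: "nat \<Rightarrow> signal \<Rightarrow> bool" where
  "null_signal d s \<longleftrightarrow> (\<forall>q<d. ((\<lambda>k. s k $ q) \<longlongrightarrow> 0) at_top)"

lemma null_signal_add:
  assumes "is_signal d t" "null_signal d s" "null_signal d t"
  shows "null_signal d (\<lambda>k. s k + t k)"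
  unfolding null_signal_def
proof safe
  fix q assume q: "q < d"
  have "((\<lambda>k. s k $ q + t k $ q) \<longlongrightarrow> 0) at_top"
    using assms q by (intro tendsto_add_zero) (auto simp: null_signal_def)
  then show "((\<lambda>k. (s k + t k) $ q) \<longlongrightarrow> 0) at_top"
    using is_signal_dim[OF assms(1)] q by simp
qed

lemma null_signal_diff:
  assumes "is_signal d t" "null_signal d s" "null_signal d t"
  shows "null_signal d (\<lambda>k. s k - t k)"
  unfolding null_signal_def
proof safe
  fix q assume q: "q < d"
  have "((\<lambda>k. s k $ q - t k $ q) \<longlongrightarrow> 0 - 0) at_top"
    using assms q by (intro tendsto_diff) (auto simp: null_signal_def)
  then show "((\<lambda>k. (s k - t k) $ q) \<longlongrightarrow> 0) at_top"
    using is_signal_dim[OF assms(1)] q by simp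
qed

text \<open>The guard \<open>c \<noteq> 0\<close> serves the root of the tree, where the coefficient
  \<beta> of the parent's signals is 0 and no decay of these signals is available.\<close>

lemma null_signal_smult:
  assumes "is_signal d s" "c \<noteq> 0 \<Longrightarrow> null_signal d s"
  shows "null_signal d (\<lambda>k. c \<cdot>\<^sub>v s k)"
  using assms
  by (cases "c = 0") (auto simp: null_signal_def is_signal_dim intro!: tendsto_mult_right_zero)

lemma null_signal_mult_mat:
  assumes M: "M \<in> carrier_mat d d'" and s: "is_signal d' s" "null_signal d' s"
  shows "null_signal d (\<lambda>k. M *\<^sub>v s k)"
  unfolding null_signal_def
proof safe
  fix q assume q: "q < d"
  have "((\<lambda>k. \<Sum>j<d'. M $$ (q, j) * s k $ j) \<longlongrightarrow> 0) at_top"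
    using s by (intro tendsto_null_sum tendsto_mult_right_zero) (auto simp: null_signal_def)
  then show "((\<lambda>k. (M *\<^sub>v s k) $ q) \<longlongrightarrow> 0) at_top"
    using M q is_signal_dim[OF s(1)] by (simp add: scalar_prod_def atLeast0LessThan)
qed

lemma null_signal_shift:
  assumes "null_signal d s"
  shows "null_signal d (\<lambda>k. s (k + c))"
proof -
  have "filterlim (\<lambda>k::int. k + c) at_top at_top"
    unfolding filterlim_at_top
  proof
    fix Z show "eventually (\<lambda>k. Z \<le> k + c) at_top"
      using eventually_ge_at_top[of "Z - c"] by eventually_elim simp
  qed
  then show ?thesis
    using assms unfolding null_signal_def by (auto intro: filterlim_compose)
qed

text \<open>Decay is proved by induction over natural numbers counted from a start time
  \<open>T\<close>. The map \<open>nat (k - T)\<close> inverts the shift once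
  \<open>k \<ge> T\<close> and leads back to integer time.\<close>

lemma null_signal_shift_natI:
  assumes "\<And>q. q < d \<Longrightarrow> (\<lambda>k. s (int k + T) $ q) \<longlonglongrightarrow> 0"
  shows "null_signal d s"
  unfolding null_signal_def
proof safe
  fix q assume "q < d"
  have "filterlim (\<lambda>k. nat (k - T)) sequentially at_top"
    unfolding filterlim_at_top
  proof
    fix Z show "eventually (\<lambda>k. Z \<le> nat (k - T)) at_top"
      using eventually_ge_at_top[of "int Z + T"] by eventually_elim simp
  qed
  from filterlim_compose[OF assms[OF \<open>q < d\<close>] this]
  have "((\<lambda>k. s (int (nat (k - T)) + T) $ q) \<longlongrightarrow> 0) at_top" .
  then show "((\<lambda>k. s k $ q) \<longlongrightarrow> 0) at_top"
    by (rule Lim_transform_eventually) (auto intro: eventually_mono[OF eventually_ge_at_top[of T]])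
qed

lemma null_signal_shift_natD:
  assumes "null_signal d s" "q < d"
  shows "(\<lambda>k. s (int k + T) $ q) \<longlonglongrightarrow> 0"
proof -
  have "((\<lambda>k. s (k + T) $ q) \<longlongrightarrow> 0) at_top"
    using null_signal_shift[OF assms(1)] assms(2) by (auto simp: null_signal_def)
  from filterlim_compose[OF this filterlim_int_sequentially] show ?thesis .
qed

section \<open>Stable systems with vanishing input\<close>

text \<open>With a geometric bound on the powers of \<open>M\<close>, induction on time gives a bound on
  \<open>M\<^sup>j v(k)\<close> for all \<open>j\<close> simultaneously, which avoids the variation-of-constants formula.\<close>
lemma schur_stable_forced_null:
  assumes M: "M \<in> carrier_mat n n" and st: "schur_stable M"
    and v: "is_signal n v" and w: "is_signal n w" and w0: "null_signal n w"
    and rec: "\<And>k. k \<ge> T \<Longrightarrow> v (k + 1) = M *\<^sub>v v k + w k"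
  shows "null_signal n v"
proof -
  obtain c r where c: "0 \<le> c" and r: "0 \<le> r" "r < 1"
    and bd: "\<And>k i j. i < n \<Longrightarrow> j < n \<Longrightarrow> \<bar>(M ^\<^sub>m k) $$ (i, j)\<bar> \<le> c * r ^ k"
    using schur_stable_pow_bound[OF M st] by blast
  define nrm where "nrm x = (\<Sum>q<n. \<bar>x $ q\<bar>)" for x :: "real vec"
  have nrm0: "0 \<le> nrm x" for x by (auto simp: nrm_def intro: sum_nonneg)
  have carr: "v k \<in> carrier_vec n" "w k \<in> carrier_vec n" for k
    using v w by (auto simp: is_signal_def)
  have Mp: "M ^\<^sub>m j \<in> carrier_mat n n" for j using M by simp
  have pb: "\<bar>(M ^\<^sub>m j *\<^sub>v x) $ q\<bar> \<le> r ^ j * (c * nrm x)" if "x \<in> carrier_vec n" "q < n" for j x q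
  proof -
    have "\<bar>(M ^\<^sub>m j *\<^sub>v x) $ q\<bar> = \<bar>\<Sum>i<n. (M ^\<^sub>m j) $$ (q, i) * x $ i\<bar>"
      using that Mp[of j] M by (simp add: scalar_prod_def atLeast0LessThan)
    also have "\<dots> \<le> (\<Sum>i<n. \<bar>(M ^\<^sub>m j) $$ (q, i) * x $ i\<bar>)" by (rule sum_abs)
    also have "\<dots> \<le> (\<Sum>i<n. c * r ^ j * \<bar>x $ i\<bar>)"
      using that bd by (intro sum_mono) (auto simp: abs_mult intro: mult_right_mono)
    also have "\<dots> = r ^ j * (c * nrm x)"
      by (simp add: nrm_def sum_distrib_left[symmetric] algebra_simps)
    finally show ?thesis .
  qed
  define b where "b k = c * nrm (w (int k + T))" for k
  \<comment> \<open>The recurrence is chosen so that \<open>r ^ j * s k\<close> survives one time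
    step: \<open>r ^ Suc j * s k + r ^ j * b k\<close> is exactly
    \<open>r ^ j * s (Suc k)\<close>.\<close>
  define s where "s = rec_nat (c * nrm (v T)) (\<lambda>k y. r * y + b k)"
  have s_simps: "s 0 = c * nrm (v T)" "s (Suc k) = r * s k + b k" for k
    by (auto simp: s_def)
  have b0: "0 \<le> b k" for k using c nrm0 by (auto simp: b_def)
  have s0: "0 \<le> s k" for k
    by (induction k) (use c nrm0 r b0 in \<open>auto simp: s_simps\<close>)
  have "(\<lambda>k. nrm (w (int k + T))) \<longlonglongrightarrow> 0"
    unfolding nrm_def
    by (intro tendsto_null_sum tendsto_rabs_zero null_signal_shift_natD[OF w0]) auto
  then have "b \<longlonglongrightarrow> 0" unfolding b_def by (intro tendsto_mult_right_zero)
  then have lim: "s \<longlonglongrightarrow> 0"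
    using contraction_recurrence_tendsto_0[of r s b] r s0 s_simps(2) by simp
  \<comment> \<open>The exponent stays quantified, since the bound at \<open>Suc k\<close> for
    \<open>j\<close> uses the bound at \<open>k\<close> for \<open>Suc j\<close>. The case
    \<open>j = 0\<close> is the one wanted in the end.\<close>
  have key: "\<forall>j. \<forall>q<n. \<bar>(M ^\<^sub>m j *\<^sub>v v (int k + T)) $ q\<bar> \<le> r ^ j * s k" for k
  proof (induction k)
    case 0
    show ?case using pb carr by (simp add: s_simps)
  next
    case (Suc k)
    show ?case
    proof (intro allI impI)
      fix j q assume q: "q < n"
      have "v (int (Suc k) + T) = M *\<^sub>v v (int k + T) + w (int k + T)"
        using rec[of "int k + T"] by (simp add: algebra_simps)
      then have "M ^\<^sub>m j *\<^sub>v v (int (Suc k) + T) =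
          M ^\<^sub>m Suc j *\<^sub>v v (int k + T) + M ^\<^sub>m j *\<^sub>v w (int k + T)"
        using mult_add_distrib_mat_vec[OF Mp[of j], of "M *\<^sub>v v (int k + T)" "w (int k + T)"] M carr
          assoc_mult_mat_vec[OF Mp[of j] M carr(1)] by simp
      then have "\<bar>(M ^\<^sub>m j *\<^sub>v v (int (Suc k) + T)) $ q\<bar> \<le>
          \<bar>(M ^\<^sub>m Suc j *\<^sub>v v (int k + T)) $ q\<bar> + \<bar>(M ^\<^sub>m j *\<^sub>v w (int k + T)) $ q\<bar>"
        using q M by (simp del: pow_mat.simps index_mult_mat_vec)
      also have "\<dots> \<le> r ^ Suc j * s k + r ^ j * b k"
        unfolding b_def by (rule add_mono[OF Suc[rule_format, OF q] pb[OF carr(2) q]])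
      also have "\<dots> = r ^ j * s (Suc k)" by (simp add: s_simps algebra_simps)
      finally show "\<bar>(M ^\<^sub>m j *\<^sub>v v (int (Suc k) + T)) $ q\<bar> \<le> r ^ j * s (Suc k)" .
    qed
  qed
  show ?thesis
  proof (rule null_signal_shift_natI)
    fix q assume q: "q < n"
    have "\<bar>v (int k + T) $ q\<bar> \<le> s k" for k
      using key[of k, rule_format, of q 0] q carr M by simp
    then have "(\<lambda>k. \<bar>v (int k + T) $ q\<bar>) \<longlonglongrightarrow> 0"
      by (intro tendsto_sandwich[OF _ _ tendsto_const lim]) auto
    then show "(\<lambda>k. v (int k + T) $ q) \<longlonglongrightarrow> 0" by (rule tendsto_rabs_zero_cancel)
  qed
qed

section \<open>Error dynamics of a single agent\<close>

text \<open>Closed loop of one agent. The parent enters through \<open>h\<close> (its tracking error) and through \<open>g\<close> and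
  \<open>g'\<close> (its protocol variable with the protocol delay and with the output delay, respectively).\<close>
lemma cascade_step:
  fixes \<alpha> :: real
  assumes A: "A \<in> carrier_mat n n" and B: "B \<in> carrier_mat n m" and C: "C \<in> carrier_mat p n"
    and K: "K \<in> carrier_mat m n" and H: "H \<in> carrier_mat n p"
    and disc: "spectrum_in_closed_disc A"
    and sK: "schur_stable (A - B * K)" and sH: "schur_stable (A - H * C)"
    and \<alpha>: "0 < \<alpha>" "\<alpha> < 1"
    and sig: "is_signal n e" "is_signal n \<chi>" "is_signal n xh"
    and sig_in: "is_signal n h" "is_signal n g" "is_signal n g'"
    and null_in: "null_signal n h" "null_signal n g" "null_signal n g'"
    and e: "\<And>k. k \<ge> T \<Longrightarrow> e (k + 1) = A *\<^sub>v e k - (B * K) *\<^sub>v \<chi> k"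
    and h: "\<And>k. k \<ge> T \<Longrightarrow> h (k + 1) = A *\<^sub>v h k - (B * K) *\<^sub>v g' k"
    and xh: "\<And>k. k \<ge> T \<Longrightarrow> xh (k + 1) = A *\<^sub>v xh k - (B * K) *\<^sub>v (\<alpha> \<cdot>\<^sub>v \<chi> k - g k)
        + H *\<^sub>v (C *\<^sub>v (\<alpha> \<cdot>\<^sub>v e k - h k) - C *\<^sub>v xh k)"
    and \<chi>: "\<And>k. k \<ge> T \<Longrightarrow> \<chi> (k + 1) = A *\<^sub>v \<chi> k - (B * K) *\<^sub>v \<chi> k + A *\<^sub>v xh k
        - A *\<^sub>v (\<alpha> \<cdot>\<^sub>v \<chi> k - g k)"
  shows "null_signal n e \<and> null_signal n \<chi>"
proof -
  have c [simp]: "e k \<in> carrier_vec n" "\<chi> k \<in> carrier_vec n" "xh k \<in> carrier_vec n"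
    "h k \<in> carrier_vec n" "g k \<in> carrier_vec n" "g' k \<in> carrier_vec n" for k
    using sig sig_in by (auto simp: is_signal_def)
  have d [simp]: "dim_vec (e k) = n" "dim_vec (\<chi> k) = n" "dim_vec (xh k) = n"
    "dim_vec (h k) = n" "dim_vec (g k) = n" "dim_vec (g' k) = n" for k
    using c by (auto simp del: c)
  define BK where "BK = B * K"
  have BK: "BK \<in> carrier_mat n n" using B K by (simp add: BK_def)
  have HC: "H * C \<in> carrier_mat n n" using H C by simp
  have HCv: "H *\<^sub>v (C *\<^sub>v v - C *\<^sub>v w) = (H * C) *\<^sub>v (v - w)"
    if "v \<in> carrier_vec n" "w \<in> carrier_vec n" for v w
    using mult_minus_distrib_mat_vec[OF C that] that H C
    by (simp add: assoc_mult_mat_vec[of H n p C n "v - w"])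
  have dims [simp]: "dim_row A = n" "dim_row BK = n" "dim_row H = n"
    using A BK H by auto
  have lin: "M *\<^sub>v (v - w) = M *\<^sub>v v - M *\<^sub>v w" "M *\<^sub>v (v + w) = M *\<^sub>v v + M *\<^sub>v w"
    if "v \<in> carrier_vec n" "w \<in> carrier_vec n" "M \<in> {A, BK, H * C}" for v w M
    using that A BK HC mult_minus_distrib_mat_vec[of M n n v w]
      mult_add_distrib_mat_vec[of M n n v w] by auto
  have lin_smult: "M *\<^sub>v (c \<cdot>\<^sub>v v) = c \<cdot>\<^sub>v (M *\<^sub>v v)"
    if "v \<in> carrier_vec n" "M \<in> {A, BK, H * C}" for v c M
    using that A BK HC mult_mat_vec[of M n n v c] by auto
  have mat_diff: "(A - M) *\<^sub>v v = A *\<^sub>v v - M *\<^sub>v v"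
    if "v \<in> carrier_vec n" "M \<in> {A, BK, H * C}" for v M
    using that A BK HC minus_mult_distrib_mat_vec[of A n n M v] by auto
  note lins = lin lin_smult mat_diff right_diff_distrib distrib_left left_diff_distrib
  \<comment> \<open>The observer state \<open>xh\<close> estimates
    \<open>\<alpha> \<cdot>\<^sub>v e k - h k\<close>, whose image under \<open>C\<close> is the
    measurement, and \<epsilon> is the estimation error. The signal \<delta> tells how far the
    feedback from \<chi> is from feedback of the true error \<open>e\<close>.\<close>
  define \<epsilon> where "\<epsilon> k = (\<alpha> \<cdot>\<^sub>v e k - h k) - xh k" for k
  define \<delta> where "\<delta> k = e k - \<chi> k" for k
  have sig': "is_signal n \<epsilon>" "is_signal n \<delta>" by (auto simp: is_signal_def \<epsilon>_def \<delta>_def)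
  have sig_diff: "is_signal n (\<lambda>k. g' k - g k)" "is_signal n (\<lambda>k. (h k - g k) + \<epsilon> k)"
    by (auto simp: is_signal_def \<epsilon>_def)
  \<comment> \<open>The terms in \<chi> cancel. Of the parent's feedback only
    \<open>g' k - g k\<close> remains, because the output and the protocol variable travel with
    different delays.\<close>
  have \<epsilon>_rec: "\<epsilon> (k + 1) = (A - H * C) *\<^sub>v \<epsilon> k + BK *\<^sub>v (g' k - g k)" if k: "k \<ge> T" for k
  proof -
    have "\<epsilon> (k + 1) = (\<alpha> \<cdot>\<^sub>v (A *\<^sub>v e k - BK *\<^sub>v \<chi> k) - (A *\<^sub>v h k - BK *\<^sub>v g' k))
      - (A *\<^sub>v xh k - BK *\<^sub>v (\<alpha> \<cdot>\<^sub>v \<chi> k - g k) + (H * C) *\<^sub>v \<epsilon> k)"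
      using e[OF k] h[OF k] xh[OF k] by (simp add: \<epsilon>_def BK_def HCv)
    also have "\<dots> = (A - H * C) *\<^sub>v \<epsilon> k + BK *\<^sub>v (g' k - g k)"
      by (rule eq_vecI) (simp_all add: \<epsilon>_def lins del: index_mult_mat_vec)
    finally show ?thesis .
  qed
  have \<epsilon>_in: "null_signal n (\<lambda>k. BK *\<^sub>v (g' k - g k))"
    by (rule null_signal_mult_mat[OF BK sig_diff(1) null_signal_diff[OF sig_in(2) null_in(3,2)]])
  have \<epsilon>0: "null_signal n \<epsilon>"
  proof (rule schur_stable_forced_null)
    show "A - H * C \<in> carrier_mat n n" by (rule minus_carrier_mat[OF HC])
    show "is_signal n (\<lambda>k. BK *\<^sub>v (g' k - g k))" by (rule is_signal_mult_mat[OF BK])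
    show "schur_stable (A - H * C)" by (rule sH)
    show "is_signal n \<epsilon>" by (rule sig'(1))
    show "null_signal n (\<lambda>k. BK *\<^sub>v (g' k - g k))" by (rule \<epsilon>_in)
    show "\<And>k. T \<le> k \<Longrightarrow> \<epsilon> (k + 1) = (A - H * C) *\<^sub>v \<epsilon> k + BK *\<^sub>v (g' k - g k)" by (rule \<epsilon>_rec)
  qed
  \<comment> \<open>The factor \<open>1 - \<alpha>\<close> carries the closed unit disc into the
    open one, and \<open>\<alpha> < 1\<close> makes it nonzero, so that eigenvalues can be scaled
    back.\<close>
  have sA: "schur_stable ((1 - \<alpha>) \<cdot>\<^sub>m A)"
    unfolding schur_stable_def
  proof safe
    fix l assume "eigenvalue (map_mat complex_of_real ((1 - \<alpha>) \<cdot>\<^sub>m A)) l"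
    moreover have "map_mat complex_of_real ((1 - \<alpha>) \<cdot>\<^sub>m A) =
        complex_of_real (1 - \<alpha>) \<cdot>\<^sub>m map_mat complex_of_real A"
      by (rule eq_matI) auto
    ultimately have "eigenvalue (map_mat complex_of_real A) (l / complex_of_real (1 - \<alpha>))"
      using A \<alpha> by (intro eigenvalue_smult_matD[of _ n]) (auto simp del: of_real_diff)
    then have "cmod (l / complex_of_real (1 - \<alpha>)) \<le> 1"
      using disc by (auto simp: spectrum_in_closed_disc_def)
    then have "cmod l \<le> 1 - \<alpha>" using \<alpha> by (simp add: norm_divide del: of_real_diff)
    then show "cmod l < 1" using \<alpha> by simp
  qed
  \<comment> \<open>The terms in \<open>BK\<close> cancel. Since \<open>xh\<close> is
    \<open>\<alpha> e - h - \<epsilon>\<close>, the correction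
    \<open>xh - (\<alpha> \<chi> - g)\<close> equals
    \<open>\<alpha> \<delta> - (h - g) - \<epsilon>\<close>, and its first term reduces the factor
    of \<open>A\<close> from 1 to \<open>1 - \<alpha>\<close>.\<close>
  have \<delta>_rec: "\<delta> (k + 1) = ((1 - \<alpha>) \<cdot>\<^sub>m A) *\<^sub>v \<delta> k + A *\<^sub>v ((h k - g k) + \<epsilon> k)" if k: "k \<ge> T" for k
  proof -
    have "\<delta> (k + 1) = (A *\<^sub>v e k - BK *\<^sub>v \<chi> k)
      - (A *\<^sub>v \<chi> k - BK *\<^sub>v \<chi> k + A *\<^sub>v xh k - A *\<^sub>v (\<alpha> \<cdot>\<^sub>v \<chi> k - g k))"
      using e[OF k] \<chi>[OF k] by (simp add: \<delta>_def BK_def)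
    also have "\<dots> = (1 - \<alpha>) \<cdot>\<^sub>v (A *\<^sub>v \<delta> k) + A *\<^sub>v ((h k - g k) + \<epsilon> k)"
      by (rule eq_vecI) (simp_all add: \<epsilon>_def \<delta>_def lins del: index_mult_mat_vec)
    also have "(1 - \<alpha>) \<cdot>\<^sub>v (A *\<^sub>v \<delta> k) = ((1 - \<alpha>) \<cdot>\<^sub>m A) *\<^sub>v \<delta> k"
      by (rule eq_vecI) (use A in \<open>auto simp: \<delta>_def\<close>)
    finally show ?thesis .
  qed
  have \<delta>_in: "null_signal n (\<lambda>k. A *\<^sub>v ((h k - g k) + \<epsilon> k))"
    by (rule null_signal_mult_mat[OF A sig_diff(2)
          null_signal_add[OF sig'(1) null_signal_diff[OF sig_in(2) null_in(1,2)] \<epsilon>0]])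
  have \<delta>0: "null_signal n \<delta>"
  proof (rule schur_stable_forced_null)
    show "(1 - \<alpha>) \<cdot>\<^sub>m A \<in> carrier_mat n n" using A by simp
    show "is_signal n (\<lambda>k. A *\<^sub>v ((h k - g k) + \<epsilon> k))" by (rule is_signal_mult_mat[OF A])
    show "schur_stable ((1 - \<alpha>) \<cdot>\<^sub>m A)" by (rule sA)
    show "is_signal n \<delta>" by (rule sig'(2))
    show "null_signal n (\<lambda>k. A *\<^sub>v ((h k - g k) + \<epsilon> k))" by (rule \<delta>_in)
    show "\<And>k. T \<le> k \<Longrightarrow> \<delta> (k + 1) = ((1 - \<alpha>) \<cdot>\<^sub>m A) *\<^sub>v \<delta> k + A *\<^sub>v ((h k - g k) + \<epsilon> k)" by (rule \<delta>_rec)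
  qed
  \<comment> \<open>Replacing \<chi> by \<open>e - \<delta>\<close> exposes the nominal state
    feedback.\<close>
  have e_rec: "e (k + 1) = (A - BK) *\<^sub>v e k + BK *\<^sub>v \<delta> k" if k: "k \<ge> T" for k
    unfolding e[OF k] BK_def[symmetric]
    by (rule eq_vecI) (simp_all add: \<delta>_def lins del: index_mult_mat_vec)
  have e_in: "null_signal n (\<lambda>k. BK *\<^sub>v \<delta> k)"
    by (rule null_signal_mult_mat[OF BK sig'(2) \<delta>0])
  have e0: "null_signal n e"
  proof (rule schur_stable_forced_null)
    show "A - BK \<in> carrier_mat n n" by (rule minus_carrier_mat[OF BK])
    show "is_signal n (\<lambda>k. BK *\<^sub>v \<delta> k)" by (rule is_signal_mult_mat[OF BK])
    show "schur_stable (A - BK)" using sK by (simp add: BK_def)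
    show "is_signal n e" by (rule sig(1))
    show "null_signal n (\<lambda>k. BK *\<^sub>v \<delta> k)" by (rule e_in)
    show "\<And>k. T \<le> k \<Longrightarrow> e (k + 1) = (A - BK) *\<^sub>v e k + BK *\<^sub>v \<delta> k" by (rule e_rec)
  qed
  have "(\<lambda>k. e k - \<delta> k) = \<chi>"
    by (rule ext, rule eq_vecI) (auto simp: \<delta>_def)
  with null_signal_diff[OF sig'(2) e0 \<delta>0] have "null_signal n \<chi>" by (simp only:)
  with e0 show ?thesis ..
qed

section \<open>Rows of the expanded Laplacian\<close>

text \<open>For the root the coefficient \<open>\<beta>\<close> is 0 and \<open>j\<close> is immaterial.\<close>
lemma l_bar_row_sum:
  assumes g: "graph_class N a" and i: "i \<in> {1..N}"
  obtains \<alpha> j \<beta> where "0 < \<alpha>" "\<alpha> < 1" "j \<in> {1..N}" "\<beta> \<noteq> 0 \<longrightarrow> parent N a j i"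
    "\<forall>f :: nat \<Rightarrow> real. (1 / (2 + d_in N a i)) * (\<Sum>l=1..N. l_bar N a i l * f l) = \<alpha> * f i - \<beta> * f j"
proof (cases "i = 1")
  case True
  have a0: "a 1 l = 0" if "l \<in> {1..N}" for l
    using g that graph_class_root(1,2)[OF g] unfolding graph_class_def weighted_graph_def parent_def
    by (metis order_le_less)
  then have d: "d_in N a 1 = 0" by (simp add: d_in_def)
  have "(\<Sum>l=1..N. l_bar N a 1 l * f l) = (\<Sum>l=1..N. if l = 1 then f 1 else 0)" for f :: "nat \<Rightarrow> real"
    using a0 by (intro sum.cong) (auto simp: l_bar_def laplacian_def iota_def)
  \<comment> \<open>The root row has the single entry 1, contributed by \<open>iota\<close>, and is
    divided by \<open>2 + 0\<close>.\<close>
  then show ?thesis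
    using that[of "1 / 2" i 0] i True d by simp
next
  case False
  obtain j where j: "parent N a j i" and uniq: "\<And>l. parent N a l i \<Longrightarrow> l = j"
    using graph_class_root(3)[OF g i False] by blast
  have ne: "j \<noteq> i" using parent_less[OF g j] by simp
  have jN: "j \<in> {1..N}" and w: "0 < a i j" using j by (auto simp: parent_def)
  have a0: "a i l = (if l = j then a i j else 0)" if "l \<in> {1..N}" for l
    using g i that uniq unfolding graph_class_def weighted_graph_def parent_def
    by (metis order_le_less)
  have "d_in N a i = (\<Sum>l=1..N. if l = j then a i j else 0)"
    unfolding d_in_def using a0 by (intro sum.cong) auto
  then have d: "d_in N a i = a i j" using jN by simp
  have "(\<Sum>l=1..N. l_bar N a i l * f l) =
      (\<Sum>l=1..N. (if l = i then a i j * f i else 0) - (if l = j then a i j * f j else 0))"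
    for f :: "nat \<Rightarrow> real"
  proof (intro sum.cong refl)
    fix l assume "l \<in> {1..N}"
    then show "l_bar N a i l * f l =
        (if l = i then a i j * f i else 0) - (if l = j then a i j * f j else 0)"
      using a0[of l] ne False d by (auto simp: l_bar_def laplacian_def iota_def d_in_def)
  qed
  then have "(\<Sum>l=1..N. l_bar N a i l * f l) = a i j * f i - a i j * f j" for f :: "nat \<Rightarrow> real"
    using i jN by (simp add: sum_subtractf)
  \<comment> \<open>The row has \<open>a i j\<close> on the diagonal and its negative at the parent.
    The summand 2 in the denominator keeps the quotient below 1.\<close>
  then show ?thesis
    using that[of "a i j / (2 + a i j)" j "a i j / (2 + a i j)"] w jN j d
    by (simp add: diff_divide_distrib)
qed

text \<open>The dimension \<open>d\<close> is quantified inside, because the same \<alpha>,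
  \<open>j\<close> and \<beta> must serve the outputs in dimension \<open>p\<close> and the protocol
  variables in dimension \<open>n\<close>.\<close>

lemma l_bar_row_lin_comb:
  assumes g: "graph_class N a" and i: "i \<in> {1..N}"
  obtains \<alpha> j \<beta> where "0 < \<alpha>" "\<alpha> < 1" "j \<in> {1..N}" "\<beta> \<noteq> 0 \<longrightarrow> parent N a j i"
    "\<forall>d v. v i \<in> carrier_vec d \<longrightarrow> v j \<in> carrier_vec d \<longrightarrow>
      (1 / (2 + d_in N a i)) \<cdot>\<^sub>v lin_comb d N (l_bar N a i) v = \<alpha> \<cdot>\<^sub>v v i - \<beta> \<cdot>\<^sub>v v j"
proof -
  obtain \<alpha> j \<beta> where 1: "0 < \<alpha>" "\<alpha> < 1" "j \<in> {1..N}" "\<beta> \<noteq> 0 \<longrightarrow> parent N a j i" and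
    sum: "\<forall>f :: nat \<Rightarrow> real. (1 / (2 + d_in N a i)) * (\<Sum>l=1..N. l_bar N a i l * f l) = \<alpha> * f i - \<beta> * f j"
    using l_bar_row_sum[OF g i] .
  show ?thesis
  proof (rule that[OF 1], intro allI impI)
    fix d and v :: "nat \<Rightarrow> real vec" assume "v i \<in> carrier_vec d" "v j \<in> carrier_vec d"
    then show "(1 / (2 + d_in N a i)) \<cdot>\<^sub>v lin_comb d N (l_bar N a i) v = \<alpha> \<cdot>\<^sub>v v i - \<beta> \<cdot>\<^sub>v v j"
      using sum[rule_format, of "\<lambda>l. v l $ q" for q] by (intro eq_vecI) (auto simp: lin_comb_def)
  qed
qed

section \<open>Induction along the tree\<close>

text \<open>The decay of \<chi> belongs to the claim because each agent receives delayed copies of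
  its parent's \<chi> as inputs. Induction on the index follows the tree, since a parent has a
  smaller index than its child.\<close>

lemma protocol_errors_null:
  assumes A: "A \<in> carrier_mat n n" and B: "B \<in> carrier_mat n m" and C: "C \<in> carrier_mat p n"
    and K: "K \<in> carrier_mat m n" and H: "H \<in> carrier_mat n p"
    and disc: "spectrum_in_closed_disc A"
    and sK: "schur_stable (A - B * K)" and sH: "schur_stable (A - H * C)"
    and g: "graph_class N a" and \<kappa>: "comm_delays N \<kappa>" and \<kappa>h: "comm_delays N \<kappa>h"
    and exo: "exosystem n p A C xr yr" and ag: "agents n m p A B C N x u y"
    and sig: "\<And>i. i \<in> {1..N} \<Longrightarrow> is_signal n (xh i)" "\<And>i. i \<in> {1..N} \<Longrightarrow> is_signal n (\<chi> i)"
    and xh: "\<And>i k. i \<in> {1..N} \<Longrightarrow> k \<ge> 0 \<Longrightarrow>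
      xh i (k + 1) = A *\<^sub>v xh i k - (B * K) *\<^sub>v zeta_hat n N a \<kappa>h \<chi> i k
        + H *\<^sub>v (zeta_bar p N a \<kappa> \<kappa>1r y yr i k - C *\<^sub>v xh i k)"
    and \<chi>: "\<And>i k. i \<in> {1..N} \<Longrightarrow> k \<ge> 0 \<Longrightarrow>
      \<chi> i (k + 1) = A *\<^sub>v \<chi> i k + B *\<^sub>v u i k + A *\<^sub>v xh i k
        - A *\<^sub>v zeta_hat n N a \<kappa>h \<chi> i k"
    and u: "\<And>i k. i \<in> {1..N} \<Longrightarrow> k \<ge> 0 \<Longrightarrow> u i k = - (K *\<^sub>v \<chi> i k)"
  shows "i \<in> {1..N} \<Longrightarrow>
    null_signal n (\<lambda>k. x i k - xr (k - int (exo_delay N a \<kappa> \<kappa>1r i))) \<and> null_signal n (\<chi> i)"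
proof (induction i rule: less_induct)
  case (less i)
  note i = less.prems
  obtain \<alpha> j \<beta> where \<alpha>: "0 < \<alpha>" "\<alpha> < 1" and j: "j \<in> {1..N}" and par: "\<beta> \<noteq> 0 \<longrightarrow> parent N a j i"
    and row: "\<forall>d v. v i \<in> carrier_vec d \<longrightarrow> v j \<in> carrier_vec d \<longrightarrow>
      (1 / (2 + d_in N a i)) \<cdot>\<^sub>v lin_comb d N (l_bar N a i) v = \<alpha> \<cdot>\<^sub>v v i - \<beta> \<cdot>\<^sub>v v j"
    using l_bar_row_lin_comb[OF g i] .
  note par = par[rule_format] and row = row[rule_format]
  define \<rho> where "\<rho> = int (exo_delay N a \<kappa> \<kappa>1r i)"
  define e where "e k = x i k - xr (k - \<rho>)" for k
  \<comment> \<open>The reference is delayed by the \<rho> of agent \<open>i\<close>, not of agent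
    \<open>j\<close>. For a true parent, \<open>exo_delay_parent\<close> identifies \<open>f\<close>
    with the parent's own tracking error delayed by \<open>\<kappa> i j\<close>.\<close>
  define f where "f k = x j (k - int (\<kappa> i j)) - xr (k - \<rho>)" for k
  \<comment> \<open>The system equations hold from time 0 on and are invoked at \<open>k\<close>,
    \<open>k - \<rho>\<close> and \<open>k - int (\<kappa> i j)\<close>. The sum of the two delays
    makes all three nonnegative.\<close>
  define T where "T = \<rho> + int (\<kappa> i j)"
  have T: "k \<ge> 0" "k - \<rho> \<ge> 0" "k - int (\<kappa> i j) \<ge> 0" if "k \<ge> T" for k
    using that by (auto simp: T_def \<rho>_def)
  have \<kappa>0: "\<kappa> i i = 0" "\<kappa>h i i = 0" using i \<kappa> \<kappa>h by (auto simp: comm_delays_def)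
  have xc: "x l k \<in> carrier_vec n" "y l k \<in> carrier_vec p" if "l \<in> {1..N}" for l k
    using ag that by (auto simp: agents_def is_signal_def)
  have rc: "xr k \<in> carrier_vec n" "yr k \<in> carrier_vec p" for k
    using exo by (auto simp: exosystem_def is_signal_def)
  have \<chi>c: "\<chi> l k \<in> carrier_vec n" "xh l k \<in> carrier_vec n" if "l \<in> {1..N}" for l k
    using sig that by (auto simp: is_signal_def)
  note carr = xc[OF i] xc[OF j] rc \<chi>c[OF i] \<chi>c[OF j]
  have sig_ef: "is_signal n e" "is_signal n f"
    using carr by (auto simp: is_signal_def e_def f_def)
  have Bu: "B *\<^sub>v u l k = - ((B * K) *\<^sub>v \<chi> l k)" if "l \<in> {1..N}" "k \<ge> 0" for l k
    unfolding u[OF that]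
    by (rule eq_vecI) (use B K \<chi>c[OF that(1), of k] in \<open>auto simp: assoc_mult_mat_vec[of B n m K n]\<close>)
  \<comment> \<open>One formula covers both errors: \<open>d = 0\<close> gives \<open>e\<close>, and
    \<open>d = int (\<kappa> i j)\<close> with the parent's index gives \<open>f\<close>.\<close>
  have dyn: "x l (k + 1 - d) - xr (k + 1 - \<rho>) = A *\<^sub>v (x l (k - d) - xr (k - \<rho>)) - (B * K) *\<^sub>v \<chi> l (k - d)"
    if l: "l \<in> {1..N}" and k: "k - d \<ge> 0" "k - \<rho> \<ge> 0" for l k d
  proof -
    have "x l ((k - d) + 1) = A *\<^sub>v x l (k - d) + B *\<^sub>v u l (k - d)"
      using ag l k(1) unfolding agents_def by blast
    moreover have "xr ((k - \<rho>) + 1) = A *\<^sub>v xr (k - \<rho>)"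
      using exo k(2) unfolding exosystem_def by blast
    moreover have "A *\<^sub>v (x l (k - d) - xr (k - \<rho>)) = A *\<^sub>v x l (k - d) - A *\<^sub>v xr (k - \<rho>)"
      using A xc[OF l] rc by (simp add: mult_minus_distrib_mat_vec)
    ultimately show ?thesis
      unfolding diff_add_eq[of k _ 1]
      using A B K Bu[OF l k(1)] by (intro eq_vecI) (auto simp del: index_mult_mat_vec)
  qed
  have zh: "zeta_hat n N a \<kappa>h \<chi> i k = \<alpha> \<cdot>\<^sub>v \<chi> i k - \<beta> \<cdot>\<^sub>v \<chi> j (k - int (\<kappa>h i j))" for k
    using zeta_hat_alt[OF i \<kappa>h] sig(2) row[of "\<lambda>l. \<chi> l (k - int (\<kappa>h i l))" n] \<kappa>0 carr by simp
  have zb: "zeta_bar p N a \<kappa> \<kappa>1r y yr i k = C *\<^sub>v (\<alpha> \<cdot>\<^sub>v e k - \<beta> \<cdot>\<^sub>v f k)" if "k \<ge> T" for k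
  proof -
    have Cy: "y l (k - d) - yr (k - \<rho>) = C *\<^sub>v (x l (k - d) - xr (k - \<rho>))"
      if "l \<in> {1..N}" "k - d \<ge> 0" for l d
      using ag exo that T(2)[OF \<open>k \<ge> T\<close>] C xc[OF that(1)] rc
      unfolding agents_def exosystem_def by (simp add: mult_minus_distrib_mat_vec)
    have "zeta_bar p N a \<kappa> \<kappa>1r y yr i k =
        \<alpha> \<cdot>\<^sub>v (y i k - yr (k - \<rho>)) - \<beta> \<cdot>\<^sub>v (y j (k - int (\<kappa> i j)) - yr (k - \<rho>))"
      using row[of "\<lambda>l. y l (k - int (\<kappa> i l)) - yr (k - \<rho>)" p] \<kappa>0 carr
      by (simp add: zeta_bar_def \<rho>_def)
    also have "\<dots> = \<alpha> \<cdot>\<^sub>v (C *\<^sub>v e k) - \<beta> \<cdot>\<^sub>v (C *\<^sub>v f k)"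
      using Cy[OF i, of 0] Cy[OF j, of "int (\<kappa> i j)"] T[OF that] by (simp add: e_def f_def)
    also have "\<dots> = C *\<^sub>v (\<alpha> \<cdot>\<^sub>v e k - \<beta> \<cdot>\<^sub>v f k)"
      using C sig_ef by (simp add: is_signal_def mult_minus_distrib_mat_vec mult_mat_vec)
    finally show ?thesis .
  qed
  have IH: "null_signal n f" "null_signal n (\<lambda>k. \<chi> j (k - d))" if "\<beta> \<noteq> 0" for d
  proof -
    note p = par[OF that]
    have IH: "null_signal n (\<lambda>k. x j k - xr (k - int (exo_delay N a \<kappa> \<kappa>1r j)))" "null_signal n (\<chi> j)"
      using less.IH[OF parent_less[OF g p] j] by auto
    show "null_signal n f"
      using null_signal_shift[OF IH(1), of "- int (\<kappa> i j)"] exo_delay_parent[OF g p, of \<kappa> \<kappa>1r]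
      by (simp add: f_def[abs_def] \<rho>_def algebra_simps)
    show "null_signal n (\<lambda>k. \<chi> j (k - d))"
      using null_signal_shift[OF IH(2), of "- d"] by simp
  qed
  have \<chi>d: "is_signal n (\<lambda>k. \<chi> j (k - d))" for d using carr by (auto simp: is_signal_def)
  have "null_signal n e \<and> null_signal n (\<chi> i)"
  proof (rule cascade_step[OF A B C K H disc sK sH \<alpha>, where
        h = "\<lambda>k. \<beta> \<cdot>\<^sub>v f k" and g = "\<lambda>k. \<beta> \<cdot>\<^sub>v \<chi> j (k - int (\<kappa>h i j))"
        and g' = "\<lambda>k. \<beta> \<cdot>\<^sub>v \<chi> j (k - int (\<kappa> i j))" and xh = "xh i" and T = T])
    fix k assume k: "T \<le> k"
    show "e (k + 1) = A *\<^sub>v e k - (B * K) *\<^sub>v \<chi> i k"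
      using dyn[OF i, of k 0] T[OF k] by (simp add: e_def)
    show "\<beta> \<cdot>\<^sub>v f (k + 1) = A *\<^sub>v (\<beta> \<cdot>\<^sub>v f k) - (B * K) *\<^sub>v (\<beta> \<cdot>\<^sub>v \<chi> j (k - int (\<kappa> i j)))"
    proof -
      have "f (k + 1) = A *\<^sub>v f k - (B * K) *\<^sub>v \<chi> j (k - int (\<kappa> i j))"
        using dyn[OF j, of k "int (\<kappa> i j)"] T[OF k] by (simp add: f_def)
      then have "\<beta> \<cdot>\<^sub>v f (k + 1) =
          \<beta> \<cdot>\<^sub>v (A *\<^sub>v f k) - \<beta> \<cdot>\<^sub>v ((B * K) *\<^sub>v \<chi> j (k - int (\<kappa> i j)))"
        using A B K by (intro eq_vecI) (auto simp: right_diff_distrib simp del: index_mult_mat_vec)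
      moreover have "A *\<^sub>v (\<beta> \<cdot>\<^sub>v f k) = \<beta> \<cdot>\<^sub>v (A *\<^sub>v f k)"
        using A sig_ef(2) by (intro mult_mat_vec) (auto simp: is_signal_def)
      moreover have "(B * K) *\<^sub>v (\<beta> \<cdot>\<^sub>v \<chi> j (k - int (\<kappa> i j))) = \<beta> \<cdot>\<^sub>v ((B * K) *\<^sub>v \<chi> j (k - int (\<kappa> i j)))"
        using B K carr by (intro mult_mat_vec[of _ n n]) auto
      ultimately show ?thesis by (simp only:)
    qed
    show "xh i (k + 1) = A *\<^sub>v xh i k - (B * K) *\<^sub>v (\<alpha> \<cdot>\<^sub>v \<chi> i k - \<beta> \<cdot>\<^sub>v \<chi> j (k - int (\<kappa>h i j)))
        + H *\<^sub>v (C *\<^sub>v (\<alpha> \<cdot>\<^sub>v e k - \<beta> \<cdot>\<^sub>v f k) - C *\<^sub>v xh i k)"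
      using xh[OF i T(1)[OF k]] by (simp add: zh zb[OF k])
    show "\<chi> i (k + 1) = A *\<^sub>v \<chi> i k - (B * K) *\<^sub>v \<chi> i k + A *\<^sub>v xh i k
        - A *\<^sub>v (\<alpha> \<cdot>\<^sub>v \<chi> i k - \<beta> \<cdot>\<^sub>v \<chi> j (k - int (\<kappa>h i j)))"
    proof -
      have "A *\<^sub>v \<chi> i k + B *\<^sub>v u i k = A *\<^sub>v \<chi> i k - (B * K) *\<^sub>v \<chi> i k"
        using A B K Bu[OF i T(1)[OF k]] by (intro eq_vecI) (auto simp del: index_mult_mat_vec)
      then show ?thesis using \<chi>[OF i T(1)[OF k]] by (simp add: zh)
    qed
  \<comment> \<open>If \<beta> is 0, the three inputs vanish identically; otherwise \<open>j\<close>
    is the parent and the induction hypothesis applies.\<close>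
  qed (use sig_ef sig[OF i] \<chi>d IH in \<open>auto simp: is_signal_def intro!: null_signal_smult\<close>)
  then show ?case by (simp add: e_def[abs_def] \<rho>_def)
qed

section \<open>State-space form of the protocol\<close>

text \<open>A block row is encoded as a \<open>four_block_mat\<close> whose lower blocks have no
  rows, so that the multiplication rule for block matrices applies.\<close>

lemma mat_beside_mult_vec:
  fixes P Q :: "real mat"
  assumes "P \<in> carrier_mat nr n1" "Q \<in> carrier_mat nr n2" "v \<in> carrier_vec n1" "w \<in> carrier_vec n2"
  shows "four_block_mat P Q (0\<^sub>m 0 n1) (0\<^sub>m 0 n2) *\<^sub>v (v @\<^sub>v w) = P *\<^sub>v v + Q *\<^sub>v w"
  using four_block_mat_mult_vec[OF assms(1,2), of "0\<^sub>m 0 n1" 0 "0\<^sub>m 0 n2" v w] assms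
  by (auto intro!: eq_vecI)

theorem theorem2:
  fixes A B C :: "real mat" and n m p :: nat
  assumes A: "A \<in> carrier_mat n n" and B: "B \<in> carrier_mat n m" and C: "C \<in> carrier_mat p n"
    and disc: "spectrum_in_closed_disc A"
    and stab: "stabilizable n m A B"
    and det: "detectable n p A C"
  shows "scalable_sync_solvable n m p A B C \<and>
    (\<forall>K \<in> carrier_mat m n. \<forall>H \<in> carrier_mat n p.
       schur_stable (A - B * K) \<longrightarrow> schur_stable (A - H * C) \<longrightarrow>
       (\<forall>N a \<kappa> \<kappa>h \<kappa>1r xr yr x u y xh \<chi>.
          graph_class N a \<longrightarrow> comm_delays N \<kappa> \<longrightarrow> comm_delays N \<kappa>h \<longrightarrow>
          exosystem n p A C xr yr \<longrightarrow> agents n m p A B C N x u y \<longrightarrow>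
          (\<forall>i\<in>{1..N}. is_signal n (xh i) \<and> is_signal n (\<chi> i) \<and>
             (\<forall>k\<ge>0.
                xh i (k + 1) = A *\<^sub>v xh i k - (B * K) *\<^sub>v zeta_hat n N a \<kappa>h \<chi> i k
                  + H *\<^sub>v (zeta_bar p N a \<kappa> \<kappa>1r y yr i k - C *\<^sub>v xh i k) \<and>
                \<chi> i (k + 1) = A *\<^sub>v \<chi> i k + B *\<^sub>v u i k + A *\<^sub>v xh i k
                  - A *\<^sub>v zeta_hat n N a \<kappa>h \<chi> i k \<and>
                u i k = - (K *\<^sub>v \<chi> i k))) \<longrightarrow>
          synchronized n N a \<kappa> \<kappa>1r x xr))"
proof -
  \<comment> \<open>This is the second conjunct; it also yields the first one through the
    realization constructed below.\<close>
  have sync: "synchronized n N a \<kappa> \<kappa>1r x xr"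
    if "K \<in> carrier_mat m n" "H \<in> carrier_mat n p"
      "schur_stable (A - B * K)" "schur_stable (A - H * C)"
      "graph_class N a" "comm_delays N \<kappa>" "comm_delays N \<kappa>h"
      "exosystem n p A C xr yr" "agents n m p A B C N x u y"
      and prot: "\<forall>i\<in>{1..N}. is_signal n (xh i) \<and> is_signal n (\<chi> i) \<and>
             (\<forall>k\<ge>0.
                xh i (k + 1) = A *\<^sub>v xh i k - (B * K) *\<^sub>v zeta_hat n N a \<kappa>h \<chi> i k
                  + H *\<^sub>v (zeta_bar p N a \<kappa> \<kappa>1r y yr i k - C *\<^sub>v xh i k) \<and>
                \<chi> i (k + 1) = A *\<^sub>v \<chi> i k + B *\<^sub>v u i k + A *\<^sub>v xh i k
                  - A *\<^sub>v zeta_hat n N a \<kappa>h \<chi> i k \<and>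
                u i k = - (K *\<^sub>v \<chi> i k))"
    for K H N a \<kappa> \<kappa>h \<kappa>1r xr yr x u y xh \<chi>
    using protocol_errors_null[OF A B C that(1,2) disc that(3-9), of xh \<chi> \<kappa>1r] prot
    unfolding synchronized_def null_signal_def by blast
  obtain K where K: "K \<in> carrier_mat m n" and sK: "schur_stable (A - B * K)"
    using stab by (auto simp: stabilizable_def)
  obtain H where H: "H \<in> carrier_mat n p" and sH: "schur_stable (A - H * C)"
    using det by (auto simp: detectable_def)
  define BK where "BK = B * K"
  define HC where "HC = H * C"
  have BK: "BK \<in> carrier_mat n n" and HC: "HC \<in> carrier_mat n n"
    using B K H C by (auto simp: BK_def HC_def)
  \<comment> \<open>Realization on the stacked state of \<open>xh\<close> over \<chi>, with
    \<open>u = - K \<chi>\<close> substituted. \<open>Hc\<close> reads off the lower half, and all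
    five matrices are built from the agent model and the two gains alone.\<close>
  define Ac where "Ac = four_block_mat (A - HC) (0\<^sub>m n n) A (A - BK)"
  define Bc1 where "Bc1 = H @\<^sub>r 0\<^sub>m n p"
  define Bc2 where "Bc2 = (- BK) @\<^sub>r (- A)"
  define Fc where "Fc = four_block_mat (0\<^sub>m m n) (- K) (0\<^sub>m 0 n) (0\<^sub>m 0 n)"
  define Hc where "Hc = four_block_mat (0\<^sub>m n n) (1\<^sub>m n :: real mat) (0\<^sub>m 0 n) (0\<^sub>m 0 n)"
  have "protocol_synchronizes n m p A B C (n + n) Ac Bc1 Bc2 Fc Hc"
    unfolding protocol_synchronizes_def
  proof (intro allI impI)
    fix N a \<kappa> \<kappa>h \<kappa>1r xr yr x u y xc \<xi>
    assume g: "graph_class N a" and \<kappa>: "comm_delays N \<kappa>" "comm_delays N \<kappa>h"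
      and sys: "exosystem n p A C xr yr" "agents n m p A B C N x u y"
      and pr: "\<forall>i\<in>{1..N}. is_signal (n + n) (xc i) \<and> is_signal n (\<xi> i) \<and>
           (\<forall>k\<ge>0. xc i (k + 1) = Ac *\<^sub>v xc i k + Bc1 *\<^sub>v zeta_bar p N a \<kappa> \<kappa>1r y yr i k
                      + Bc2 *\<^sub>v zeta_hat n N a \<kappa>h \<xi> i k \<and>
                  u i k = Fc *\<^sub>v xc i k \<and>
                  \<xi> i k = Hc *\<^sub>v xc i k)"
    define xh where "xh i k = vec_first (xc i k) n" for i k
    show "synchronized n N a \<kappa> \<kappa>1r x xr"
    \<comment> \<open>\<chi> is instantiated by \<xi> rather than by the lower half of
      \<open>xc\<close>: the two agree from time 0 on, but at negative times, which
      \<open>zeta_hat\<close> may read, \<xi> is free initial data.\<close>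
    proof (rule sync[OF K H sK sH g \<kappa> sys, where xh = xh and \<chi> = \<xi>], intro ballI conjI allI impI)
      fix i assume i: "i \<in> {1..N}"
      show "is_signal n (xh i)" by (simp add: is_signal_def xh_def)
      show "is_signal n (\<xi> i)" using pr i by blast
      have \<xi>c: "\<xi> i k \<in> carrier_vec n" for k using \<open>is_signal n (\<xi> i)\<close> by (simp add: is_signal_def)
      have xhc: "xh i k \<in> carrier_vec n" for k by (simp add: xh_def)
      have split: "xc i k = xh i k @\<^sub>v \<xi> i k" if "k \<ge> 0" for k
      proof -
        have "xc i k \<in> carrier_vec (n + n)" using pr i by (auto simp: is_signal_def)
        then have s: "xc i k = xh i k @\<^sub>v vec_last (xc i k) n" by (simp add: xh_def)
        have "\<xi> i k = Hc *\<^sub>v xc i k" using pr i that by blast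
        also have "\<dots> = vec_last (xc i k) n"
          by (subst s, unfold Hc_def, subst mat_beside_mult_vec[of _ n n _ n]) (auto simp: xh_def)
        finally show ?thesis using s by simp
      qed
      fix k :: int assume k: "0 \<le> k"
      define zb where "zb = zeta_bar p N a \<kappa> \<kappa>1r y yr i k"
      define zh where "zh = zeta_hat n N a \<kappa>h \<xi> i k"
      have z: "zb \<in> carrier_vec p" "zh \<in> carrier_vec n"
        by (auto simp: zb_def zh_def zeta_bar_def zeta_hat_def lin_comb_def intro!: carrier_vecI)
      have uk: "u i k = - (K *\<^sub>v \<xi> i k)"
      proof -
        have "u i k = Fc *\<^sub>v xc i k" using pr i k by blast
        also have "\<dots> = Fc *\<^sub>v (xh i k @\<^sub>v \<xi> i k)" by (simp only: split[OF k])
        also have "\<dots> = 0\<^sub>m m n *\<^sub>v xh i k + (- K) *\<^sub>v \<xi> i k"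
          unfolding Fc_def using K \<xi>c xhc by (intro mat_beside_mult_vec) auto
        finally show ?thesis using K \<xi>c[of k] xhc[of k] by (auto intro!: eq_vecI)
      qed
      have "xh i (k + 1) @\<^sub>v \<xi> i (k + 1) = xc i (k + 1)" using split[of "k + 1"] k by simp
      also have "xc i (k + 1) = Ac *\<^sub>v xc i k + Bc1 *\<^sub>v zb + Bc2 *\<^sub>v zh"
        unfolding zb_def zh_def using pr i k by blast
      also have "xc i k = xh i k @\<^sub>v \<xi> i k" by (rule split[OF k])
      also have "Ac *\<^sub>v (xh i k @\<^sub>v \<xi> i k) =
          ((A - HC) *\<^sub>v xh i k + 0\<^sub>m n n *\<^sub>v \<xi> i k) @\<^sub>v (A *\<^sub>v xh i k + (A - BK) *\<^sub>v \<xi> i k)"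
        unfolding Ac_def using A BK HC \<xi>c xhc by (intro four_block_mat_mult_vec) auto
      also have "Bc1 *\<^sub>v zb = (H *\<^sub>v zb) @\<^sub>v (0\<^sub>m n p *\<^sub>v zb)"
        unfolding Bc1_def using H z by (intro mat_mult_append) auto
      also have "Bc2 *\<^sub>v zh = ((- BK) *\<^sub>v zh) @\<^sub>v ((- A) *\<^sub>v zh)"
        unfolding Bc2_def using A BK z by (intro mat_mult_append) auto
      also have "(((A - HC) *\<^sub>v xh i k + 0\<^sub>m n n *\<^sub>v \<xi> i k) @\<^sub>v (A *\<^sub>v xh i k + (A - BK) *\<^sub>v \<xi> i k))
          + ((H *\<^sub>v zb) @\<^sub>v (0\<^sub>m n p *\<^sub>v zb)) + (((- BK) *\<^sub>v zh) @\<^sub>v ((- A) *\<^sub>v zh)) =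
          (((A - HC) *\<^sub>v xh i k + 0\<^sub>m n n *\<^sub>v \<xi> i k) + H *\<^sub>v zb + (- BK) *\<^sub>v zh) @\<^sub>v
          ((A *\<^sub>v xh i k + (A - BK) *\<^sub>v \<xi> i k) + 0\<^sub>m n p *\<^sub>v zb + (- A) *\<^sub>v zh)"
        using A BK HC H by (intro eq_vecI) (auto simp del: index_mult_mat_vec)
      finally have eq: "xh i (k + 1) @\<^sub>v \<xi> i (k + 1) =
          (((A - HC) *\<^sub>v xh i k + 0\<^sub>m n n *\<^sub>v \<xi> i k) + H *\<^sub>v zb + (- BK) *\<^sub>v zh) @\<^sub>v
          ((A *\<^sub>v xh i k + (A - BK) *\<^sub>v \<xi> i k) + 0\<^sub>m n p *\<^sub>v zb + (- A) *\<^sub>v zh)" .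
      \<comment> \<open>Equal length of the upper halves permits splitting the stacked equation into
        its two components.\<close>
      have "((A - HC) *\<^sub>v xh i k + 0\<^sub>m n n *\<^sub>v \<xi> i k) + H *\<^sub>v zb + (- BK) *\<^sub>v zh \<in> carrier_vec n"
        using BK by (intro carrier_vecI) simp
      note next_step = append_vec_eq[OF xhc this, THEN iffD1, OF eq]
      have next1: "xh i (k + 1) = ((A - HC) *\<^sub>v xh i k + 0\<^sub>m n n *\<^sub>v \<xi> i k) + H *\<^sub>v zb + (- BK) *\<^sub>v zh"
        using next_step by (rule conjunct1)
      have next2: "\<xi> i (k + 1) = (A *\<^sub>v xh i k + (A - BK) *\<^sub>v \<xi> i k) + 0\<^sub>m n p *\<^sub>v zb + (- A) *\<^sub>v zh"
        using next_step by (rule conjunct2)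
      have v1: "(A - HC) *\<^sub>v xh i k = A *\<^sub>v xh i k - HC *\<^sub>v xh i k"
        by (rule minus_mult_distrib_mat_vec[OF A HC xhc])
      have v2: "(A - BK) *\<^sub>v \<xi> i k = A *\<^sub>v \<xi> i k - BK *\<^sub>v \<xi> i k"
        by (rule minus_mult_distrib_mat_vec[OF A BK \<xi>c])
      have v3: "(- BK) *\<^sub>v zh = - (BK *\<^sub>v zh)" "(- A) *\<^sub>v zh = - (A *\<^sub>v zh)"
        using A BK z by auto
      have v4: "0\<^sub>m n n *\<^sub>v \<xi> i k = 0\<^sub>v n" "0\<^sub>m n p *\<^sub>v zb = 0\<^sub>v n"
        using \<xi>c z by (auto intro!: eq_vecI)
      have v5: "H *\<^sub>v (zb - C *\<^sub>v xh i k) = H *\<^sub>v zb - HC *\<^sub>v xh i k"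
        unfolding HC_def using H C z xhc[of k]
        by (simp add: mult_minus_distrib_mat_vec[of H n p] assoc_mult_mat_vec[of H n p C n])
      have v6: "B *\<^sub>v (- (K *\<^sub>v \<xi> i k)) = - (BK *\<^sub>v \<xi> i k)"
        by (rule eq_vecI) (use B K \<xi>c[of k] in \<open>auto simp: BK_def assoc_mult_mat_vec[of B n m K n]\<close>)
      show "xh i (k + 1) = A *\<^sub>v xh i k - (B * K) *\<^sub>v zeta_hat n N a \<kappa>h \<xi> i k
          + H *\<^sub>v (zeta_bar p N a \<kappa> \<kappa>1r y yr i k - C *\<^sub>v xh i k)"
        unfolding zb_def[symmetric] zh_def[symmetric] BK_def[symmetric] next1 v1 v3 v4 v5
        using A BK HC H by (intro eq_vecI) (auto simp del: index_mult_mat_vec)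
      show "\<xi> i (k + 1) = A *\<^sub>v \<xi> i k + B *\<^sub>v u i k + A *\<^sub>v xh i k - A *\<^sub>v zeta_hat n N a \<kappa>h \<xi> i k"
        unfolding zh_def[symmetric] next2 uk v2 v3 v4 v6
        using A BK by (intro eq_vecI) (auto simp del: index_mult_mat_vec)
      show "u i k = - (K *\<^sub>v \<xi> i k)" by (rule uk)
    qed
  qed
  moreover have "Ac \<in> carrier_mat (n + n) (n + n)"
    unfolding Ac_def using HC BK by (intro four_block_carrier_mat minus_carrier_mat)
  moreover have "Bc1 \<in> carrier_mat (n + n) p" "Bc2 \<in> carrier_mat (n + n) n"
    unfolding Bc1_def Bc2_def using H A BK by (auto intro!: carrier_append_rows)
  moreover have "Fc \<in> carrier_mat m (n + n)"
    using four_block_carrier_mat[of "0\<^sub>m m n" m n "0\<^sub>m 0 n" 0 n "- K" "0\<^sub>m 0 n"] by (simp add: Fc_def)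
  moreover have "Hc \<in> carrier_mat n (n + n)"
    using four_block_carrier_mat[of "0\<^sub>m n n" n n "0\<^sub>m 0 n" 0 n "1\<^sub>m n :: real mat" "0\<^sub>m 0 n"]
    by (simp add: Hc_def)
  ultimately have "scalable_sync_solvable n m p A B C"
    unfolding scalable_sync_solvable_def by blast
  with sync show ?thesis by blast
qed

end
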